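(* Let $G$ be a simple graph with $n$ vertices, with $S_{a,b}(G)$ and $f_{i,j}$ as defined in the context. Then for all integers $0\le a\le b\le n-2$: (i) $$S_{a,b}(G)=\begin{cases}\displaystyle \sum_{i=0}^{n-2} \sum_{j=i}^{n-2} \left( \binom{i}{a}\binom{j}{b}+ \binom{i}{b}\binom{j}{a} \right) f_{i,j}, & a<b,\\[2mm] \displaystyle \sum_{i=0}^{n-2} \sum_{j=i}^{n-2} \binom{i}{a}\binom{j}{a} f_{i,j}, & a=b; \end{cases}$$ (ii) $$f_{a,b}=\begin{cases}\displaystyle \sum_{i=0}^{n-2} \sum_{j=i}^{n-2} (-1)^{a+b+i+j} \left( \binom{i}{a}\binom{j}{b}+ \binom{i}{b}\binom{j}{a} \right) S_{i,j}(G), & a<b,\\[2mm] \displaystyle \sum_{i=0}^{n-2}\sum_{j=i}^{n-2} (-1)^{i+j} \binom{i}{a} \binom{j}{a}S_{i,j}(G), & a=b. \end{cases}$$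
   Context: $G$ is a finite simple graph with vertex set $V(G)$, $|V(G)|=n$, and edge set $E(G)$; $d_v$ denotes the degree of a vertex $v$. For integers $0\le a\le b$, the double star count $S_{a,b}(G)$ is defined by $$S_{a,b}(G)=\begin{cases} \displaystyle \sum_{\{u,v\} \in E(G)} \left( \binom{d_u-1}{a}\binom{d_v-1}{b}+ \binom{d_u-1}{b}\binom{d_v-1}{a} \right), & a < b,\\ \displaystyle \sum_{\{u,v\} \in E(G)} \binom{d_u-1}{a}\binom{d_v-1}{a}, & a = b. \end{cases}$$ (The paper describes this as the number of copies of the double star tree $S_{a,b}$, whose degree sequence is $a+1,b+1$ followed by $a+b$ ones, counted via a central edge.) For integers $0\le i\le j$, $f_{i,j}$ denotes the number of edges $\{u,v\}\in E(G)$ with $\{d_u-1,d_v-1\}=\{i,j\}$ as multisets, i.e. $\min(d_u,d_v)=i+1$ and $\max(d_u,d_v)=j+1$. Binomial coefficients $\binom{x}{k}$ are $0$ when $k>x$. *)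

theory Defs
  imports Main "HOL-Library.Multiset"
begin

locale simple_graph =
  fixes V :: "'a set" and E :: "'a set set"
  assumes finite_vertices: "finite V"
    and edges: "e \<in> E \<Longrightarrow> e \<subseteq> V \<and> card e = 2"

definition degree :: "'a set set \<Rightarrow> 'a \<Rightarrow> nat" where
  "degree E v = card {e \<in> E. v \<in> e}"

text \<open>
  The sum over all edges \<open>{u, v}\<close> of \<open>F u v\<close>, for \<open>F\<close> symmetric.  The value \<open>F u v\<close> is
  attached to the unordered pair by definite description, so each edge is counted once;
  it is well defined exactly because of the symmetry (lemma \<open>edge_value\<close> below).
\<close>

definition edge_value :: "('a \<Rightarrow> 'a \<Rightarrow> nat) \<Rightarrow> 'a set \<Rightarrow> nat" where
  "edge_value F e = (THE x. \<exists>u v. e = {u, v} \<and> x = F u v)"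

definition edge_sum :: "'a set set \<Rightarrow> ('a \<Rightarrow> 'a \<Rightarrow> nat) \<Rightarrow> nat" where
  "edge_sum E F = (\<Sum>e\<in>E. edge_value F e)"

lemma edge_value:
  assumes "\<And>x y. F x y = F y x"
  shows "edge_value F {u, v} = F u v"
  unfolding edge_value_def
  by (rule the_equality) (use assms in \<open>auto simp: doubleton_eq_iff\<close>)

text \<open>
  Only used for \<open>a \<le> b\<close>.  The end points of an edge have positive degree, so the
  truncated subtractions \<open>degree E u - 1\<close> are genuine ones, here and in \<open>edge_type_count\<close>.
\<close>

definition double_star_count :: "'a set set \<Rightarrow> nat \<Rightarrow> nat \<Rightarrow> nat" where
  "double_star_count E a b =
    (if a < b then
       edge_sum E (\<lambda>u v. ((degree E u - 1) choose a) * ((degree E v - 1) choose b)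
                       + ((degree E u - 1) choose b) * ((degree E v - 1) choose a))
     else
       edge_sum E (\<lambda>u v. ((degree E u - 1) choose a) * ((degree E v - 1) choose a)))"

definition edge_type_count :: "'a set set \<Rightarrow> nat \<Rightarrow> nat \<Rightarrow> nat" where
  "edge_type_count E i j =
    card {e \<in> E. \<exists>u v. e = {u, v} \<and> {#degree E u - 1, degree E v - 1#} = {#i, j#}}"

end

theory Submission
  imports Defs
begin

text \<open>
  Both double star counts and edge type counts depend only on the multiset of pairs \<open>p \<le> q\<close> of
  reduced degrees (degree minus one) of the end points of the edges, and linearly so: an edge with
  reduced degrees \<open>p, q\<close> contributes
  \<open>double_star_weight a b p q\<close> to \<open>S\<^sub>a\<^sub>,\<^sub>b\<close>, which gives (i).  The sums over \<open>i \<le> j\<close> in (ii) unfold to sums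
  over all ordered pairs \<open>(i, j)\<close>, where they factor into two binomial inversions
  \<open>\<Sum>i. (-1)\<^sup>a\<^sup>+\<^sup>i (i choose a) (p choose i) = [a = p]\<close>.
\<close>

section \<open>Binomial inversion for single indices and for ordered pairs\<close>

lemma binomial_inversion:
  fixes a p N :: nat
  assumes "p \<le> N"
  shows "(\<Sum>i\<le>N. (-1) ^ (a + i) * int (i choose a) * int (p choose i)) = (if a = p then 1 else 0)"
proof (cases "a \<le> p")
  case True
  \<comment> \<open>Only a \<le> i \<le> p contributes, and \<open>p \<le> N\<close> keeps that
    whole range inside the sum.\<close>
  have "(\<Sum>i\<le>N. (-1) ^ (a + i) * int (i choose a) * int (p choose i))
      = (\<Sum>i\<in>{a..p}. (-1) ^ (a + i) * int (i choose a) * int (p choose i))"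
    using assms by (intro sum.mono_neutral_right) (auto simp: not_le)
  also have "\<dots> = (\<Sum>k\<le>p - a. (-1) ^ (a + (k + a)) * int ((k + a) choose a) * int (p choose (k + a)))"
    by (rule sum.reindex_bij_witness[of _ "\<lambda>k. k + a" "\<lambda>i. i - a"]) (use True in auto)
  also have "\<dots> = (\<Sum>k\<le>p - a. int (p choose a) * ((-1) ^ k * int ((p - a) choose k)))"
  proof (rule sum.cong[OF refl])
    fix k assume "k \<in> {..p - a}"
    \<comment> \<open>Choosing a set of size k + a and then a of its elements amounts to choosing
      the a elements first. This pulls \<open>p choose a\<close> out of the sum and leaves an
      alternating row sum, zero unless p = a.\<close>
    then have "(p choose (k + a)) * ((k + a) choose a) = (p choose a) * ((p - a) choose k)"
      using choose_mult[of a "k + a" p] True by auto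
    then have "int ((k + a) choose a) * int (p choose (k + a)) = int (p choose a) * int ((p - a) choose k)"
      by (metis of_nat_mult mult.commute)
    moreover have "(-1) ^ (a + (k + a)) = ((-1) ^ k :: int)"
      by (simp add: power_add mult.left_commute flip: power_mult_distrib)
    ultimately show "(-1) ^ (a + (k + a)) * int ((k + a) choose a) * int (p choose (k + a))
        = int (p choose a) * ((-1) ^ k * int ((p - a) choose k))"
      by (simp add: mult.assoc mult.left_commute)
  qed
  also have "\<dots> = int (p choose a) * (\<Sum>k\<le>p - a. (-1) ^ k * int ((p - a) choose k))"
    by (simp add: sum_distrib_left)
  also have "\<dots> = (if a = p then 1 else 0)"
    using True choose_alternating_sum[of "p - a", where 'a = int] by auto
  finally show ?thesis .
next
  case False
  then have "(i choose a) * (p choose i) = 0" for i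
    by (cases "i < a") auto
  then have "(\<Sum>i\<le>N. (-1) ^ (a + i) * int (i choose a) * int (p choose i)) = 0"
    by (intro sum.neutral) auto
  with False show ?thesis by auto
qed

text \<open>Each pair i < j of the triangle stands for two entries of the square, each diagonal pair
  for one. The case split of the double star count in its indices has exactly this shape.\<close>

lemma sum_upper_triangle_symmetrised:
  fixes h :: "nat \<Rightarrow> nat \<Rightarrow> 'b :: comm_monoid_add"
  shows "(\<Sum>i\<le>N. \<Sum>j=i..N. if i < j then h i j + h j i else h i j) = (\<Sum>i\<le>N. \<Sum>j\<le>N. h i j)"
proof (induction N)
  case (Suc N)
  let ?g = "\<lambda>i j. if i < j then h i j + h j i else h i j"
  \<comment> \<open>The triangle gains only the column j = \<open>Suc N\<close>, whose entries carry
    both the new column and the new row of the square.\<close>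
  have "(\<Sum>i\<le>Suc N. \<Sum>j=i..Suc N. ?g i j)
      = (\<Sum>i\<le>N. (\<Sum>j=i..N. ?g i j) + (h i (Suc N) + h (Suc N) i)) + h (Suc N) (Suc N)"
    by (auto intro!: sum.cong arg_cong2[where f = "(+)"])
  also have "\<dots> = (\<Sum>i\<le>Suc N. \<Sum>j\<le>Suc N. h i j)"
    by (simp only: sum.distrib Suc.IH sum.atMost_Suc add.assoc add.commute add.left_commute)
  finally show ?case .
qed simp

text \<open>Serves twice: as the contribution of one edge to a double star count and, up to sign, as
  the coefficient of \<open>double_star_count E i j\<close> in (ii).\<close>

definition double_star_weight :: "nat \<Rightarrow> nat \<Rightarrow> nat \<Rightarrow> nat \<Rightarrow> nat" where
  "double_star_weight a b p q =
    (if a < b then (p choose a) * (q choose b) + (p choose b) * (q choose a)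
     else (p choose a) * (q choose a))"

lemma double_star_weight_commute: "double_star_weight a b p q = double_star_weight a b q p"
  by (simp add: double_star_weight_def)

text \<open>On index pairs i \<le> j the weight matrix is its own inverse up to signs.\<close>

lemma double_star_weight_inversion:
  assumes "a \<le> b" "p \<le> q" "q \<le> N"
  shows "(\<Sum>i\<le>N. \<Sum>j=i..N. (-1) ^ (a + b + i + j) * int (double_star_weight a b i j)
            * int (double_star_weight i j p q))
       = (if p = a \<and> q = b then 1 else 0)"
proof -
  define B where "B c r i = (-1) ^ (c + i) * int (i choose c) * int (r choose i)" for c r i :: nat
  have B_sum: "(\<Sum>i\<le>N. B c r i) = (if c = r then 1 else 0)" if "r \<le> N" for c r
    unfolding B_def by (rule binomial_inversion[OF that])
  \<comment> \<open>Of the two products in \<open>double_star_weight i j p q\<close>,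
    \<open>h i j\<close> keeps the first; the second appears in \<open>h j i\<close>, since the
    other factors are symmetric in i and j.\<close>
  define h where "h i j = (-1) ^ (a + b + i + j) * int (double_star_weight a b i j)
      * int ((p choose i) * (q choose j))" for i j
  have "(\<Sum>i\<le>N. \<Sum>j=i..N. (-1) ^ (a + b + i + j) * int (double_star_weight a b i j)
            * int (double_star_weight i j p q))
      = (\<Sum>i\<le>N. \<Sum>j=i..N. if i < j then h i j + h j i else h i j)"
  proof (intro sum.cong refl)
    fix i j assume "j \<in> {i..N}"
    moreover have "a + b + j + i = a + b + i + j" by simp
    ultimately show "(-1) ^ (a + b + i + j) * int (double_star_weight a b i j)
            * int (double_star_weight i j p q) = (if i < j then h i j + h j i else h i j)"
      unfolding h_def double_star_weight_commute[of a b j i] double_star_weight_def[of i j]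
      by (auto simp: distrib_left ac_simps)
  qed
  also have "\<dots> = (\<Sum>i\<le>N. \<Sum>j\<le>N. h i j)"
    by (rule sum_upper_triangle_symmetrised)
  also have "\<dots> = (if a < b then (\<Sum>i\<le>N. \<Sum>j\<le>N. B a p i * B b q j + B b p i * B a q j)
                 else (\<Sum>i\<le>N. \<Sum>j\<le>N. B a p i * B a q j))"
    using assms(1) by (auto simp: h_def B_def double_star_weight_def power_add algebra_simps intro!: sum.cong)
  \<comment> \<open>If a < b, the swapped product [b = p][a = q] vanishes because p \<le> q.\<close>
  also have "\<dots> = (if p = a \<and> q = b then 1 else 0)"
    using assms by (auto simp: sum.distrib B_sum simp flip: sum_product)
  finally show ?thesis .
qed

section \<open>Reduced degrees of the end points of an edge\<close>

context simple_graph
begin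

lemma finite_edges: "finite E"
  using finite_vertices edges by (intro finite_subset[of E "Pow V"]) auto

lemma degree_le:
  assumes "v \<in> V"
  shows "degree E v \<le> card V - 1"
proof -
  have "{e \<in> E. v \<in> e} \<subseteq> (\<lambda>u. {v, u}) ` (V - {v})"
  proof
    fix e assume "e \<in> {e \<in> E. v \<in> e}"
    then have "e \<subseteq> V" "card e = 2" "v \<in> e" using edges by auto
    then obtain u where "e = {v, u}" "u \<noteq> v"
      by (auto simp: card_2_iff)
    with \<open>e \<subseteq> V\<close> show "e \<in> (\<lambda>u. {v, u}) ` (V - {v})" by auto
  qed
  then have "degree E v \<le> card (V - {v})"
    unfolding degree_def using finite_vertices by (intro surj_card_le) auto
  with assms finite_vertices show ?thesis by simp
qed

text \<open>Minimum and maximum over the image turn an unordered edge into a sorted pair without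
  choosing an orientation; for ends of equal degree the two coincide.\<close>

definition lower_reduced_degree :: "'a set \<Rightarrow> nat" where
  "lower_reduced_degree e = Min ((\<lambda>v. degree E v - 1) ` e)"

definition upper_reduced_degree :: "'a set \<Rightarrow> nat" where
  "upper_reduced_degree e = Max ((\<lambda>v. degree E v - 1) ` e)"

lemma edge_degrees:
  assumes "e \<in> E"
  obtains u v where "e = {u, v}" "u \<in> V" "v \<in> V"
    "degree E u - 1 = lower_reduced_degree e" "degree E v - 1 = upper_reduced_degree e"
    "lower_reduced_degree e \<le> upper_reduced_degree e"
proof -
  from edges[OF assms] obtain x y where xy: "e = {x, y}" "x \<in> V" "y \<in> V"
    by (auto simp: card_2_iff)
  show thesis
  proof (cases "degree E x - 1 \<le> degree E y - 1")
    case True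
    with xy show thesis
      by (intro that[of x y]) (auto simp: lower_reduced_degree_def upper_reduced_degree_def)
  next
    case False
    with xy show thesis
      by (intro that[of y x]) (auto simp: lower_reduced_degree_def upper_reduced_degree_def)
  qed
qed

text \<open>This is why summing up to n - 2 misses no edge.\<close>

lemma upper_reduced_degree_le:
  assumes "e \<in> E"
  shows "upper_reduced_degree e \<le> card V - 2"
  using assms by (rule edge_degrees) (use degree_le in fastforce)

section \<open>Both counts as sums over edges\<close>

lemma double_star_count_eq:
  "double_star_count E a b = (\<Sum>e\<in>E. double_star_weight a b (lower_reduced_degree e) (upper_reduced_degree e))"
proof -
  have "double_star_count E a b
      = edge_sum E (\<lambda>u v. double_star_weight a b (degree E u - 1) (degree E v - 1))"
    by (simp add: double_star_count_def double_star_weight_def)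
  also have "\<dots> = (\<Sum>e\<in>E. double_star_weight a b (lower_reduced_degree e) (upper_reduced_degree e))"
    unfolding edge_sum_def
  proof (rule sum.cong[OF refl])
    fix e assume "e \<in> E"
    then show "edge_value (\<lambda>u v. double_star_weight a b (degree E u - 1) (degree E v - 1)) e
        = double_star_weight a b (lower_reduced_degree e) (upper_reduced_degree e)"
    proof (rule edge_degrees)
      fix u v assume "e = {u, v}" "degree E u - 1 = lower_reduced_degree e" "degree E v - 1 = upper_reduced_degree e"
      \<comment> \<open>Symmetry of the weight allows \<open>edge_value\<close> to be read off at
        the ends sorted by degree.\<close>
      then show ?thesis
        using edge_value[of "\<lambda>u v. double_star_weight a b (degree E u - 1) (degree E v - 1)" u v]
        by (simp add: double_star_weight_commute)
    qed
  qed
  finally show ?thesis .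
qed

lemma edge_type_count_eq:
  assumes "i \<le> j"
  shows "edge_type_count E i j = (\<Sum>e\<in>E. if lower_reduced_degree e = i \<and> upper_reduced_degree e = j then 1 else 0)"
proof -
  have "(\<exists>u v. e = {u, v} \<and> {#degree E u - 1, degree E v - 1#} = {#i, j#})
      \<longleftrightarrow> lower_reduced_degree e = i \<and> upper_reduced_degree e = j" if "e \<in> E" for e
    using that
  proof (rule edge_degrees)
    fix u v
    assume uv: "e = {u, v}" "degree E u - 1 = lower_reduced_degree e" "degree E v - 1 = upper_reduced_degree e"
      "lower_reduced_degree e \<le> upper_reduced_degree e"
    show ?thesis
    proof
      assume "\<exists>u v. e = {u, v} \<and> {#degree E u - 1, degree E v - 1#} = {#i, j#}"
      then obtain x y where "e = {x, y}" "{#degree E x - 1, degree E y - 1#} = {#i, j#}" by blast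
      \<comment> \<open>The multiset equation fixes the two values up to a swap; i \<le> j then
        decides which is the minimum.\<close>
      with assms show "lower_reduced_degree e = i \<and> upper_reduced_degree e = j"
        by (auto simp: lower_reduced_degree_def upper_reduced_degree_def add_eq_conv_ex)
    next
      assume "lower_reduced_degree e = i \<and> upper_reduced_degree e = j"
      with uv show "\<exists>u v. e = {u, v} \<and> {#degree E u - 1, degree E v - 1#} = {#i, j#}"
        by (intro exI[of _ u] exI[of _ v]) simp
    qed
  qed
  then have "edge_type_count E i j = card {e \<in> E. lower_reduced_degree e = i \<and> upper_reduced_degree e = j}"
    unfolding edge_type_count_def by (intro arg_cong[where f = card]) auto
  also have "\<dots> = (\<Sum>e\<in>E. if lower_reduced_degree e = i \<and> upper_reduced_degree e = j then 1 else 0)"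
    using finite_edges by (simp add: sum.If_cases Int_def)
  finally show ?thesis .
qed

text \<open>Double counting: every edge lies in exactly one cell (i, j) of the triangle.\<close>

lemma sum_edge_type_count:
  "(\<Sum>i\<le>card V - 2. \<Sum>j=i..card V - 2. w i j * edge_type_count E i j)
     = (\<Sum>e\<in>E. w (lower_reduced_degree e) (upper_reduced_degree e))"
proof -
  let ?N = "card V - 2"
  let ?T = "Sigma {..?N} (\<lambda>i. {i..?N})"
  have "(\<Sum>i\<le>?N. \<Sum>j=i..?N. w i j * edge_type_count E i j)
      = (\<Sum>i\<le>?N. \<Sum>j=i..?N. \<Sum>e\<in>E. if (i, j) = (lower_reduced_degree e, upper_reduced_degree e) then w i j else 0)"
    by (intro sum.cong refl) (auto simp: edge_type_count_eq sum_distrib_left intro!: sum.cong)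
  \<comment> \<open>With the two indices merged into one pair, a single delta sum picks out the cell
    of an edge.\<close>
  also have "\<dots> = (\<Sum>x\<in>?T. \<Sum>e\<in>E. if x = (lower_reduced_degree e, upper_reduced_degree e) then w (fst x) (snd x) else 0)"
    by (rule trans[OF sum.Sigma]) (auto simp: case_prod_beta intro!: sum.cong)
  also have "\<dots> = (\<Sum>e\<in>E. \<Sum>x\<in>?T. if x = (lower_reduced_degree e, upper_reduced_degree e) then w (fst x) (snd x) else 0)"
    by (rule sum.swap)
  also have "\<dots> = (\<Sum>e\<in>E. w (lower_reduced_degree e) (upper_reduced_degree e))"
  proof (rule sum.cong[OF refl])
    fix e assume "e \<in> E"
    then have "(lower_reduced_degree e, upper_reduced_degree e) \<in> ?T"
      using upper_reduced_degree_le[of e] by (auto elim: edge_degrees)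
    then show "(\<Sum>x\<in>?T. if x = (lower_reduced_degree e, upper_reduced_degree e) then w (fst x) (snd x) else 0)
        = w (lower_reduced_degree e) (upper_reduced_degree e)"
      by (subst sum.delta) auto
  qed
  finally show ?thesis .
qed

lemma edge_type_count_inversion:
  assumes "a \<le> b"
  shows "int (edge_type_count E a b)
       = (\<Sum>i\<le>card V - 2. \<Sum>j=i..card V - 2. (-1) ^ (a + b + i + j) * int (double_star_weight a b i j)
            * int (double_star_count E i j))"
proof -
  let ?N = "card V - 2"
  let ?c = "\<lambda>i j. (-1) ^ (a + b + i + j) * int (double_star_weight a b i j)"
  let ?d = "\<lambda>i j e. int (double_star_weight i j (lower_reduced_degree e) (upper_reduced_degree e))"
  have "(\<Sum>i\<le>?N. \<Sum>j=i..?N. ?c i j * int (double_star_count E i j))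
      = (\<Sum>i\<le>?N. \<Sum>j=i..?N. \<Sum>e\<in>E. ?c i j * ?d i j e)"
    by (simp add: double_star_count_eq sum_distrib_left)
  also have "\<dots> = (\<Sum>e\<in>E. \<Sum>i\<le>?N. \<Sum>j=i..?N. ?c i j * ?d i j e)"
    by (simp only: sum.swap[of _ E])
  \<comment> \<open>After the exchange of sums, the inversion applies to each edge
    separately.\<close>
  also have "\<dots> = (\<Sum>e\<in>E. if lower_reduced_degree e = a \<and> upper_reduced_degree e = b then 1 else 0)"
    using assms upper_reduced_degree_le
    by (intro sum.cong refl double_star_weight_inversion) (auto elim: edge_degrees)
  also have "\<dots> = int (edge_type_count E a b)"
    by (simp add: edge_type_count_eq[OF assms] if_distrib cong: if_cong)
  finally show ?thesis by simp
qed

end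

theorem theorem1:
  fixes V :: "'a set" and E :: "'a set set" and n a b :: nat
  assumes "simple_graph V E"
    and "card V = n"
    and "a \<le> b" and "int b \<le> int n - 2"
  shows
    "double_star_count E a b =
       (if a < b then
          (\<Sum>i=0..n-2. \<Sum>j=i..n-2.
             ((i choose a) * (j choose b) + (i choose b) * (j choose a)) * edge_type_count E i j)
        else
          (\<Sum>i=0..n-2. \<Sum>j=i..n-2.
             (i choose a) * (j choose a) * edge_type_count E i j))
     \<and>
     int (edge_type_count E a b) =
       (if a < b then
          (\<Sum>i=0..n-2. \<Sum>j=i..n-2.
             (-1) ^ (a + b + i + j)
               * int ((i choose a) * (j choose b) + (i choose b) * (j choose a))
               * int (double_star_count E i j))
        else
          (\<Sum>i=0..n-2. \<Sum>j=i..n-2.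
             (-1) ^ (i + j) * int ((i choose a) * (j choose a))
               * int (double_star_count E i j)))"
proof -
  interpret simple_graph V E by fact
  have "double_star_count E a b
      = (\<Sum>i\<le>n-2. \<Sum>j=i..n-2. double_star_weight a b i j * edge_type_count E i j)"
    using assms(2) sum_edge_type_count[of "double_star_weight a b"] by (simp add: double_star_count_eq)
  moreover have "int (edge_type_count E a b)
      = (\<Sum>i\<le>n-2. \<Sum>j=i..n-2. (-1) ^ (a + b + i + j) * int (double_star_weight a b i j)
            * int (double_star_count E i j))"
    using assms(2,3) edge_type_count_inversion by simp
  \<comment> \<open>For a = b the sign loses its even part a + a, as in the second case of
    (ii).\<close>
  moreover have "(-1) ^ (a + a + i + j) = ((-1) ^ (i + j) :: int)" for i j
    by (simp add: power_add flip: power_mult_distrib)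
  ultimately show ?thesis
    using assms(3) by (auto simp: double_star_weight_def atLeast0AtMost)
qed

end
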